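(* Let $\mathbb K$ be a field, $R=\mathbb K[x_1,\dots,x_n]$, and let $I\subseteq R$ be a stable monomial ideal. Then $I$ is a vertex splittable ideal.
   Context: For a monomial ideal $I$, $G(I)$ denotes its set of minimal monomial generators. For a monomial $m$, $\max(m)=\max\{i : x_i \text{ divides } m\}$. A monomial ideal $I\subseteq R$ is stable if $x_i\,(m/x_{\max(m)})\in I$ for all $m\in G(I)$ and all $i<\max(m)$. Vertex splittable ideals are the monomial ideals obtained by the following inductive process: (1) $I=(0)$, $I=R$ and $I=(m)$ with $m$ a monomial are vertex splittable; (2) if there exist a variable $x_i$ and two vertex splittable ideals $J\subseteq R$ and $K\subseteq \mathbb K[x_1,\dots,\widehat{x_i},\dots,x_n]$ (the polynomial ring without the variable $x_i$; $K$ is also regarded as the ideal it generates in $R$) such that $I=x_iJ+K$, $K\subseteq J$, and $G(I)$ is the disjoint union of $G(x_iJ)$ and $G(K)$, then $I$ is vertex splittable. *)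

theory Defs
  imports "HOL-Library.Poly_Mapping" "HOL-Algebra.Ideal"
begin

text \<open>
  Polynomials over the field \<open>'k\<close> in variables indexed by natural numbers are finitely supported
  maps from exponent vectors to coefficients, with the convolution product of
  \<open>HOL-Library.Poly_Mapping\<close>. For \<open>V :: nat set\<close>, the ring \<open>mpoly_ring V\<close> is \<open>K[x_i : i \<in> V]\<close>,
  so that \<open>K[x_1,\<dots>,x_n]\<close> is \<open>mpoly_ring {1..n}\<close>, and leaving out the variable \<open>x_i\<close>
  gives \<open>mpoly_ring (V - {i})\<close>, whose carrier is a subset of that of \<open>mpoly_ring V\<close>.
\<close>

type_synonym expo = "nat \<Rightarrow>\<^sub>0 nat"

type_synonym 'k mpoly = "expo \<Rightarrow>\<^sub>0 'k"

definition mpoly_ring :: "nat set \<Rightarrow> 'k::field mpoly ring"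
  where "mpoly_ring V =
    \<lparr>carrier = {p. \<forall>m\<in>Poly_Mapping.keys p. Poly_Mapping.keys m \<subseteq> V},
     monoid.mult = (*), one = 1, ring.zero = 0, add = (+)\<rparr>"

definition expos :: "nat set \<Rightarrow> expo set"
  where "expos V = {m. Poly_Mapping.keys m \<subseteq> V}"

definition monom :: "expo \<Rightarrow> 'k::field mpoly"
  where "monom m = Poly_Mapping.single m 1"

definition var_expo :: "nat \<Rightarrow> expo"
  where "var_expo i = Poly_Mapping.single i 1"

abbreviation var :: "nat \<Rightarrow> 'k::field mpoly"
  where "var i \<equiv> monom (var_expo i)"

definition monomial_ideal :: "nat set \<Rightarrow> 'k::field mpoly set \<Rightarrow> bool"
  where "monomial_ideal V I \<longleftrightarrow>
    (\<exists>S \<subseteq> expos V. I = Idl\<^bsub>mpoly_ring V\<^esub> (monom ` S))"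

definition is_min_gens :: "nat set \<Rightarrow> 'k::field mpoly set \<Rightarrow> expo set \<Rightarrow> bool"
  where "is_min_gens V I S \<longleftrightarrow>
    S \<subseteq> expos V \<and> Idl\<^bsub>mpoly_ring V\<^esub> (monom ` S) = I \<and>
    (\<forall>T. T \<subset> S \<longrightarrow> Idl\<^bsub>mpoly_ring V\<^esub> (monom ` T) \<noteq> I)"

text \<open>
  The set \<open>G(I)\<close>, with monomials given by their exponent vectors. Existence and uniqueness for
  monomial ideals are proved in \<open>ex1_min_gens\<close> below.
\<close>

definition min_gens :: "nat set \<Rightarrow> 'k::field mpoly set \<Rightarrow> expo set"
  where "min_gens V I = (THE S. is_min_gens V I S)"

text \<open>
  Variables are numbered from \<open>1\<close>, so the value \<open>0\<close> for the monomial \<open>1\<close> means that the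
  condition in \<open>stable_ideal\<close> is vacuous for this monomial.
\<close>

definition max_var :: "expo \<Rightarrow> nat"
  where "max_var m = (if m = 0 then 0 else Max (Poly_Mapping.keys m))"

definition stable_ideal :: "nat \<Rightarrow> 'k::field mpoly set \<Rightarrow> bool"
  where "stable_ideal n I \<longleftrightarrow>
    monomial_ideal {1..n} I \<and>
    (\<forall>m \<in> min_gens {1..n} I. \<forall>i \<in> {1..n}. i < max_var m \<longrightarrow>
      monom (var_expo i + (m - var_expo (max_var m))) \<in> I)"

text \<open>
  \<open>vertex_splittable V I\<close>: the ideal \<open>I\<close> of \<open>K[x_i : i \<in> V]\<close> is vertex splittable.
  In the recursive step \<open>K'\<close> is the extension to \<open>mpoly_ring V\<close> of the ideal \<open>K\<close> of the ring
  without \<open>x_i\<close>.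
\<close>

inductive vertex_splittable :: "nat set \<Rightarrow> 'k::field mpoly set \<Rightarrow> bool" where
  zero: "vertex_splittable V {\<zero>\<^bsub>mpoly_ring V\<^esub>}"
| whole: "vertex_splittable V (carrier (mpoly_ring V))"
| principal: "m \<in> expos V \<Longrightarrow> vertex_splittable V (PIdl\<^bsub>mpoly_ring V\<^esub> (monom m))"
| split: "\<lbrakk>i \<in> V; vertex_splittable V J; vertex_splittable (V - {i}) K;
    K' = Idl\<^bsub>mpoly_ring V\<^esub> K;
    I = (var i <#\<^bsub>mpoly_ring V\<^esub> J) <+>\<^bsub>mpoly_ring V\<^esub> K';
    K' \<subseteq> J;
    min_gens V I = min_gens V (var i <#\<^bsub>mpoly_ring V\<^esub> J) \<union> min_gens V K';
    min_gens V (var i <#\<^bsub>mpoly_ring V\<^esub> J) \<inter> min_gens V K' = {}\<rbrakk>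
    \<Longrightarrow> vertex_splittable V I"


subsection \<open>Well-definedness of the notions above\<close>

lemma keys_add_nat: "Poly_Mapping.keys (a + b :: expo) = Poly_Mapping.keys a \<union> Poly_Mapping.keys b"
  by (auto simp: in_keys_iff lookup_add)

lemma mpoly_ring_simps [simp]:
  "p \<in> carrier (mpoly_ring V) \<longleftrightarrow> Poly_Mapping.keys p \<subseteq> expos V"
  "p \<otimes>\<^bsub>mpoly_ring V\<^esub> q = p * q"
  "\<one>\<^bsub>mpoly_ring V\<^esub> = 1"
  "\<zero>\<^bsub>mpoly_ring V\<^esub> = 0"
  "p \<oplus>\<^bsub>mpoly_ring V\<^esub> q = p + q"
  by (auto simp: mpoly_ring_def expos_def)

lemma mult_closed_expos:
  fixes p q :: "'k::field mpoly"
  assumes "Poly_Mapping.keys p \<subseteq> expos V" "Poly_Mapping.keys q \<subseteq> expos V"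
  shows "Poly_Mapping.keys (p * q) \<subseteq> expos V"
proof
  fix m assume "m \<in> Poly_Mapping.keys (p * q)"
  then obtain a b where "m = a + b" "a \<in> Poly_Mapping.keys p" "b \<in> Poly_Mapping.keys q"
    using keys_mult[of p q] by auto
  with assms show "m \<in> expos V" by (auto simp: expos_def keys_add_nat)
qed

lemma add_closed_expos:
  fixes p q :: "'k::field mpoly"
  assumes "Poly_Mapping.keys p \<subseteq> A" "Poly_Mapping.keys q \<subseteq> A"
  shows "Poly_Mapping.keys (p + q) \<subseteq> A"
  using assms Poly_Mapping.keys_add[of p q] by blast

lemma keys_uminus_mpoly: "Poly_Mapping.keys (- p :: 'k::field mpoly) = Poly_Mapping.keys p"
  by (auto simp: in_keys_iff)

lemma cring_mpoly_ring: "cring (mpoly_ring V :: 'k::field mpoly ring)"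
proof (rule cringI)
  show "abelian_group (mpoly_ring V :: 'k mpoly ring)"
  proof (rule abelian_groupI, goal_cases)
    case (6 x)
    then show ?case by (intro bexI[of _ "- x"]) (auto simp: keys_uminus_mpoly)
  qed (simp_all add: add_closed_expos algebra_simps)
  show "Group.comm_monoid (mpoly_ring V :: 'k mpoly ring)"
    by (rule comm_monoidI) (simp_all add: mult_closed_expos algebra_simps, simp add: expos_def)
qed (simp add: algebra_simps)

definition mdvd :: "expo \<Rightarrow> expo \<Rightarrow> bool"
  where "mdvd a b \<longleftrightarrow> (\<exists>c. b = a + c)"

lemma mdvd_refl [simp]: "mdvd a a"
  by (auto simp: mdvd_def intro: exI[of _ 0])

lemma mdvd_trans: "mdvd a b \<Longrightarrow> mdvd b c \<Longrightarrow> mdvd a c"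
  by (auto simp: mdvd_def add.assoc)

lemma mdvd_antisym:
  assumes "mdvd a b" "mdvd b a" shows "a = b"
proof -
  from assms obtain c d where b: "b = a + c" and a: "a = b + d" by (auto simp: mdvd_def)
  show ?thesis
  proof (rule poly_mapping_eqI)
    fix k
    have "Poly_Mapping.lookup b k = Poly_Mapping.lookup a k + Poly_Mapping.lookup c k" by (subst b) (simp add: lookup_add)
    moreover have "Poly_Mapping.lookup a k = Poly_Mapping.lookup b k + Poly_Mapping.lookup d k" by (subst a) (simp add: lookup_add)
    ultimately show "Poly_Mapping.lookup a k = Poly_Mapping.lookup b k" by simp
  qed
qed

lemma monom_in_Idl:
  fixes p :: "'k::field mpoly"
  assumes S: "S \<subseteq> expos V" and p: "Poly_Mapping.keys p \<subseteq> {m \<in> expos V. \<exists>s\<in>S. mdvd s m}"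
  shows "p \<in> Idl\<^bsub>mpoly_ring V\<^esub> (monom ` S)"
proof -
  interpret cring "mpoly_ring V :: 'k mpoly ring" by (rule cring_mpoly_ring)
  have sub: "monom ` S \<subseteq> carrier (mpoly_ring V :: 'k mpoly ring)"
    using S by (auto simp: monom_def)
  interpret I: ideal "Idl\<^bsub>mpoly_ring V\<^esub> (monom ` S :: 'k mpoly set)" "mpoly_ring V"
    by (rule genideal_ideal[OF sub])
  show ?thesis
    using p
  proof (induction p rule: update_induct)
    case const
    then show ?case using I.zero_closed by simp
  next
    case (update f a b)
    have eq: "Poly_Mapping.update a b f = f + Poly_Mapping.single a b"
      using update.hyps by (intro poly_mapping_eqI)
        (auto simp: lookup_update lookup_add lookup_single when_def in_keys_iff)
    have "a \<in> Poly_Mapping.keys (Poly_Mapping.update a b f)"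
      "Poly_Mapping.keys f \<subseteq> Poly_Mapping.keys (Poly_Mapping.update a b f)"
      using update.hyps by (auto simp: in_keys_iff lookup_update)
    with update.prems have a: "a \<in> expos V" "\<exists>s\<in>S. mdvd s a"
      and f: "Poly_Mapping.keys f \<subseteq> {m \<in> expos V. \<exists>s\<in>S. mdvd s m}" by auto
    from a obtain s c where s: "s \<in> S" "a = s + c" by (auto simp: mdvd_def)
    have "Poly_Mapping.single a b = Poly_Mapping.single c b * monom s"
      by (simp add: s monom_def mult_single add.commute)
    moreover have "monom s \<in> Idl\<^bsub>mpoly_ring V\<^esub> (monom ` S :: 'k mpoly set)"
      using genideal_self[OF sub] s by blast
    moreover have "Poly_Mapping.single c b \<in> carrier (mpoly_ring V)"
      using a s by (auto simp: expos_def keys_add_nat)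
    ultimately have "Poly_Mapping.single a b \<in> Idl\<^bsub>mpoly_ring V\<^esub> (monom ` S)"
      using I.I_l_closed[of "monom s" "Poly_Mapping.single c b"] by simp
    with update.IH[OF f] show ?case
      using I.a_closed[of f "Poly_Mapping.single a b"] by (simp add: eq)
  qed
qed

lemma Idl_monom_eq:
  assumes S: "S \<subseteq> expos V"
  shows "Idl\<^bsub>mpoly_ring V\<^esub> (monom ` S :: 'k::field mpoly set) =
    {p. Poly_Mapping.keys p \<subseteq> {m \<in> expos V. \<exists>s\<in>S. mdvd s m}}" (is "_ = ?D")
proof
  interpret cring "mpoly_ring V :: 'k mpoly ring" by (rule cring_mpoly_ring)
  show "?D \<subseteq> Idl\<^bsub>mpoly_ring V\<^esub> (monom ` S)"
    using monom_in_Idl[OF S] by auto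
  have mult: "Poly_Mapping.keys (x * a) \<subseteq> {m \<in> expos V. \<exists>s\<in>S. mdvd s m}"
    if a: "a \<in> ?D" and x: "x \<in> carrier (mpoly_ring V)" for a x :: "'k mpoly"
  proof
    fix m assume "m \<in> Poly_Mapping.keys (x * a)"
    then obtain c d where m: "m = c + d" "c \<in> Poly_Mapping.keys x" "d \<in> Poly_Mapping.keys a"
      using keys_mult[of x a] by auto
    with a x have "c \<in> expos V" "d \<in> expos V" "\<exists>s\<in>S. mdvd s d" by auto
    moreover have "mdvd d m" using m by (auto simp: mdvd_def add.commute)
    moreover have "m \<in> expos V" using calculation m by (simp add: expos_def keys_add_nat)
    ultimately show "m \<in> {m \<in> expos V. \<exists>s\<in>S. mdvd s m}"
      by (blast intro: mdvd_trans)
  qed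
  have "ideal ?D (mpoly_ring V)"
  proof (rule idealI)
    show "subgroup ?D (add_monoid (mpoly_ring V))"
    proof (rule add.subgroupI, goal_cases)
      case 1 then show ?case by auto
    next
      case 2
      have "0 \<in> ?D" by simp
      then show ?case by blast
    next
      case (3 a)
      then have "a \<in> carrier (mpoly_ring V)" by auto
      then have "\<ominus>\<^bsub>mpoly_ring V\<^esub> a = - a"
        by (intro minus_equality) (auto simp: keys_uminus_mpoly)
      with 3 show ?case by (simp add: keys_uminus_mpoly)
    next
      case (4 a b)
      then show ?case using add_closed_expos[of a _ b] by simp
    qed
  qed (use mult in \<open>auto simp: ring_axioms mult.commute\<close>)
  moreover have "monom ` S \<subseteq> ?D" using S by (auto simp: monom_def intro: mdvd_refl)
  ultimately show "Idl\<^bsub>mpoly_ring V\<^esub> (monom ` S) \<subseteq> ?D" by (rule genideal_minimal)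
qed

lemma monom_in_Idl_iff:
  assumes "S \<subseteq> expos V"
  shows "(monom m :: 'k::field mpoly) \<in> Idl\<^bsub>mpoly_ring V\<^esub> (monom ` S) \<longleftrightarrow>
    m \<in> expos V \<and> (\<exists>s\<in>S. mdvd s m)"
  using Idl_monom_eq[OF assms, where ?'k = 'k] by (simp add: monom_def)

lemma mdvd_degree:
  assumes "mdvd a b" "a \<noteq> b"
  shows "sum (Poly_Mapping.lookup a) (Poly_Mapping.keys a) < sum (Poly_Mapping.lookup b) (Poly_Mapping.keys b)"
proof -
  from assms obtain c where c: "b = a + c" "c \<noteq> 0" by (auto simp: mdvd_def)
  then obtain k where k: "Poly_Mapping.lookup c k \<noteq> 0" by (metis lookup_zero poly_mapping_eqI)
  have "sum (Poly_Mapping.lookup a) (Poly_Mapping.keys a) = sum (Poly_Mapping.lookup a) (Poly_Mapping.keys b)"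
    by (rule sum.mono_neutral_left) (auto simp: c keys_add_nat in_keys_iff)
  also have "\<dots> < sum (Poly_Mapping.lookup b) (Poly_Mapping.keys b)"
    by (rule sum_strict_mono_ex1) (use k in \<open>auto simp: c lookup_add in_keys_iff intro!: bexI[of _ k]\<close>)
  finally show ?thesis .
qed

text \<open>The minimal generating set consists of the divisibility-minimal monomials of the ideal.\<close>

definition dvd_minimal :: "'k::field mpoly set \<Rightarrow> expo set"
  where "dvd_minimal I = {m. monom m \<in> I \<and> (\<forall>d. monom d \<in> I \<longrightarrow> mdvd d m \<longrightarrow> d = m)}"

lemma is_min_gens_iff:
  fixes I :: "'k::field mpoly set"
  assumes "monomial_ideal V I"
  shows "is_min_gens V I S \<longleftrightarrow> S = dvd_minimal I"
proof -
  from assms obtain U where U: "U \<subseteq> expos V" "I = Idl\<^bsub>mpoly_ring V\<^esub> (monom ` U)"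
    by (auto simp: monomial_ideal_def)
  have memI: "(monom m \<in> I) = (m \<in> expos V \<and> (\<exists>s\<in>U. mdvd s m))" for m
    using monom_in_Idl_iff[OF U(1), where ?'k = 'k] U(2) by simp
  have below: "\<exists>d\<in>dvd_minimal I. mdvd d m" if "monom m \<in> I" for m
    using that
  proof (induction m rule: measure_induct_rule[where
        f = "\<lambda>m. sum (Poly_Mapping.lookup m) (Poly_Mapping.keys m)"])
    case (less m)
    show ?case
    proof (cases "m \<in> dvd_minimal I")
      case True
      then show ?thesis by (intro bexI[of _ m]) auto
    next
      case False
      then obtain d where d: "monom d \<in> I" "mdvd d m" "d \<noteq> m"
        using less.prems by (auto simp: dvd_minimal_def)
      then show ?thesis using less.IH[OF mdvd_degree[OF d(2,3)] d(1)] mdvd_trans by blast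
    qed
  qed
  have MV: "dvd_minimal I \<subseteq> expos V" by (auto simp: dvd_minimal_def memI)
  have contains: "dvd_minimal I \<subseteq> T" if T: "T \<subseteq> expos V" "Idl\<^bsub>mpoly_ring V\<^esub> (monom ` T) = I" for T
  proof
    have T_mem: "(monom m \<in> I) = (m \<in> expos V \<and> (\<exists>s\<in>T. mdvd s m))" for m
      using monom_in_Idl_iff[OF T(1), where ?'k = 'k] T(2) by simp
    fix m assume m: "m \<in> dvd_minimal I"
    then obtain s where "s \<in> T" "mdvd s m" by (auto simp: dvd_minimal_def T_mem)
    moreover from this T(1) have "monom s \<in> I"
      unfolding T_mem using mdvd_refl by blast
    ultimately show "m \<in> T" using m by (auto simp: dvd_minimal_def)
  qed
  have gen: "Idl\<^bsub>mpoly_ring V\<^esub> (monom ` dvd_minimal I) = I"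
  proof -
    have "{m \<in> expos V. \<exists>s\<in>dvd_minimal I. mdvd s m} = {m \<in> expos V. \<exists>s\<in>U. mdvd s m}"
    proof (intro Set.set_eqI iffI)
      fix m assume "m \<in> {m \<in> expos V. \<exists>s\<in>dvd_minimal I. mdvd s m}"
      then obtain s where s: "m \<in> expos V" "s \<in> dvd_minimal I" "mdvd s m" by blast
      then have "monom s \<in> I" by (simp add: dvd_minimal_def)
      then obtain u where "u \<in> U" "mdvd u s" unfolding memI by blast
      with s show "m \<in> {m \<in> expos V. \<exists>s\<in>U. mdvd s m}" using mdvd_trans[of u s m] by blast
    next
      fix m assume "m \<in> {m \<in> expos V. \<exists>s\<in>U. mdvd s m}"
      then show "m \<in> {m \<in> expos V. \<exists>s\<in>dvd_minimal I. mdvd s m}"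
        using below[of m] memI[of m] by blast
    qed
    then show ?thesis
      using Idl_monom_eq[OF MV, where ?'k = 'k] Idl_monom_eq[OF U(1), where ?'k = 'k] U(2) by simp
  qed
  show ?thesis
  proof
    assume S: "is_min_gens V I S"
    then have "dvd_minimal I \<subseteq> S" by (intro contains) (auto simp: is_min_gens_def)
    moreover have "\<not> dvd_minimal I \<subset> S" using S gen unfolding is_min_gens_def by blast
    ultimately show "S = dvd_minimal I" by blast
  next
    assume S: "S = dvd_minimal I"
    show "is_min_gens V I S"
      unfolding is_min_gens_def S
    proof (intro conjI allI impI)
      fix T assume T: "T \<subset> dvd_minimal I"
      then have "T \<subseteq> expos V" using MV by blast
      with T contains[of T] show "Idl\<^bsub>mpoly_ring V\<^esub> (monom ` T) \<noteq> I" by blast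
    qed (rule MV, rule gen)
  qed
qed

lemma ex1_min_gens: "monomial_ideal V I \<Longrightarrow> \<exists>!S. is_min_gens V I S"
  by (simp add: is_min_gens_iff)

lemma min_gens_eq: "monomial_ideal V I \<Longrightarrow> min_gens V I = dvd_minimal I"
  by (simp add: min_gens_def is_min_gens_iff)

end

theory Submission
  imports Defs
begin

text \<open>
  Monomial ideals are handled through their sets of exponents, which are closed under adding
  exponents. Stability extends from the minimal generators to all monomials of \<open>I\<close>. With \<open>x\<close> the
  first variable, split \<open>I = x J + K\<close>, where \<open>J = I : x\<close> and \<open>K\<close> is generated by the monomials of
  \<open>I\<close> not divisible by \<open>x\<close>. Then \<open>x J = I \<inter> (x)\<close>, and its generators are generators of \<open>I\<close>: if
  \<open>u \<noteq> 1\<close> in \<open>I\<close> is not divisible by \<open>x\<close>, then \<open>x u\<close> is a proper multiple of \<open>x (u / x_max(u)) \<in> I\<close>.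
  Both \<open>J\<close> and \<open>K\<close> are stable. Moving all variables of a monomial of \<open>I\<close> to \<open>x\<close> shows that \<open>I \<noteq> 0\<close>
  contains some power \<open>x^d\<close>; since \<open>J\<close> contains \<open>x^(d-1)\<close>, the recursion terminates, by induction on
  the number of variables and on \<open>d\<close>.
\<close>

section \<open>Polynomials supported on a set of exponents\<close>

text \<open>No set of variables occurs here, so ideals of the ring without one variable and ideals
  of the full ring are described in the same way.\<close>

definition supported :: "expo set \<Rightarrow> 'k::field mpoly set"
  where "supported A = {p. Poly_Mapping.keys p \<subseteq> A}"

text \<open>A polynomial is a finite sum of its terms. \<open>M\<close> need not be known to be an
  ideal, so this applies to images and to sums of ideals.\<close>

lemma supported_subsetI:
  fixes M :: "'k::field mpoly set"
  assumes "0 \<in> M" and single: "\<And>a b. a \<in> A \<Longrightarrow> Poly_Mapping.single a b \<in> M"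
    and add: "\<And>p q. p \<in> M \<Longrightarrow> q \<in> M \<Longrightarrow> p + q \<in> M"
  shows "supported A \<subseteq> M"
proof
  fix p :: "'k mpoly" assume "p \<in> supported A"
  then have "Poly_Mapping.keys p \<subseteq> A" by (simp add: supported_def)
  then show "p \<in> M"
  proof (induction p rule: update_induct)
    case const
    then show ?case using assms(1) by simp
  next
    case (update f a b)
    have eq: "Poly_Mapping.update a b f = f + Poly_Mapping.single a b"
      using update.hyps by (intro poly_mapping_eqI)
        (auto simp: lookup_update lookup_add lookup_single when_def in_keys_iff)
    have "a \<in> Poly_Mapping.keys (Poly_Mapping.update a b f)"
      "Poly_Mapping.keys f \<subseteq> Poly_Mapping.keys (Poly_Mapping.update a b f)"
      using update.hyps by (auto simp: in_keys_iff lookup_update)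
    with update.prems have "a \<in> A" "Poly_Mapping.keys f \<subseteq> A" by auto
    then show ?case unfolding eq by (intro add single update.IH)
  qed
qed

lemma monom_in_supported [simp]: "(monom m :: 'k::field mpoly) \<in> supported A \<longleftrightarrow> m \<in> A"
  by (simp add: supported_def monom_def)

lemma supported_empty: "supported {} = {0}"
  by (auto simp: supported_def)

lemma supported_expos: "supported (expos V) = carrier (mpoly_ring V)"
  by (auto simp: supported_def)

lemma supported_mono: "A \<subseteq> B \<Longrightarrow> supported A \<subseteq> supported B"
  by (auto simp: supported_def)

lemma supported_coset:
  "var i <#\<^bsub>mpoly_ring V\<^esub> supported A = (supported ((+) (var_expo i) ` A) :: 'k::field mpoly set)"
  (is "?L = ?R")
proof
  have L: "?L = (*) (var i) ` supported A"
    by (auto simp: l_coset_def)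
  show "?L \<subseteq> ?R"
  proof
    fix p :: "'k mpoly" assume "p \<in> ?L"
    then obtain q where q: "p = var i * q" "Poly_Mapping.keys q \<subseteq> A"
      unfolding L by (auto simp: supported_def)
    then have "Poly_Mapping.keys p \<subseteq> (+) (var_expo i) ` A"
      using keys_mult[of "var i :: 'k mpoly" q] by (fastforce simp: monom_def)
    then show "p \<in> ?R" by (simp add: supported_def)
  qed
  show "?R \<subseteq> ?L"
    unfolding L
  proof (rule supported_subsetI)
    show "(0 :: 'k mpoly) \<in> (*) (var i) ` supported A"
      by (rule image_eqI[of _ _ 0]) (auto simp: supported_def)
  next
    fix a and b :: 'k assume "a \<in> (+) (var_expo i) ` A"
    then obtain c where c: "a = var_expo i + c" "c \<in> A" by auto
    show "Poly_Mapping.single a b \<in> (*) (var i) ` supported A"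
      by (rule image_eqI[of _ _ "Poly_Mapping.single c b"])
        (use c in \<open>auto simp: supported_def monom_def mult_single\<close>)
  next
    fix p q :: "'k mpoly" assume "p \<in> (*) (var i) ` supported A" "q \<in> (*) (var i) ` supported A"
    then obtain p' q' where *: "p = var i * p'" "p' \<in> supported A" "q = var i * q'" "q' \<in> supported A"
      by auto
    then have "p' + q' \<in> supported A"
      using add_closed_expos[of p' A q'] by (simp add: supported_def)
    then show "p + q \<in> (*) (var i) ` supported A"
      using * by (metis distrib_left image_eqI)
  qed
qed

text \<open>Each term of a polynomial can be put into one of the two summands, so sums of monomial
  ideals become unions of exponent sets.\<close>

lemma supported_Un:
  "supported A <+>\<^bsub>mpoly_ring V\<^esub> supported B = (supported (A \<union> B) :: 'k::field mpoly set)"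
  (is "?L = ?R")
proof
  have L: "?L = {p + q | p q. p \<in> supported A \<and> q \<in> supported B}"
    by (auto simp: set_add_def set_mult_def mpoly_ring_def)
  have closed: "p + q \<in> supported C" if "p \<in> supported C" "q \<in> supported C"
    for p q :: "'k mpoly" and C
    using that add_closed_expos[of p C q] by (simp add: supported_def)
  have zero: "(0 :: 'k mpoly) \<in> supported C" for C
    by (simp add: supported_def)
  show "?L \<subseteq> ?R"
    using supported_mono[of A "A \<union> B"] supported_mono[of B "A \<union> B"] closed
    unfolding L by blast
  show "?R \<subseteq> ?L"
    unfolding L
  proof (rule supported_subsetI)
    show "(0 :: 'k mpoly) \<in> {p + q | p q. p \<in> supported A \<and> q \<in> supported B}"
      using zero by (force intro: exI[of _ 0])
  next
    fix a and b :: 'k assume "a \<in> A \<union> B"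
    then consider "Poly_Mapping.single a b \<in> supported A" | "Poly_Mapping.single a b \<in> supported B"
      by (auto simp: supported_def)
    then show "Poly_Mapping.single a b \<in> {p + q | p q. p \<in> supported A \<and> q \<in> supported B}"
    proof cases
      case 1
      then show ?thesis using zero[of B] by (metis (mono_tags, lifting) add.right_neutral mem_Collect_eq)
    next
      case 2
      then show ?thesis using zero[of A] by (metis (mono_tags, lifting) add.left_neutral mem_Collect_eq)
    qed
  next
    fix p q :: "'k mpoly"
    assume "p \<in> {p + q | p q. p \<in> supported A \<and> q \<in> supported B}"
      "q \<in> {p + q | p q. p \<in> supported A \<and> q \<in> supported B}"
    then obtain p1 p2 q1 q2 where *: "p = p1 + p2" "q = q1 + q2"
      "p1 \<in> supported A" "p2 \<in> supported B" "q1 \<in> supported A" "q2 \<in> supported B" by blast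
    then have "p + q = (p1 + q1) + (p2 + q2)" by (simp add: algebra_simps)
    with * show "p + q \<in> {p + q | p q. p \<in> supported A \<and> q \<in> supported B}"
      using closed by blast
  qed
qed

section \<open>Exponent sets of monomial ideals\<close>

text \<open>For \<open>A\<close> inside \<open>expos V\<close> these are the exponents of the ideal
  generated by \<open>A\<close>. If \<open>A\<close> uses fewer variables, this describes the
  extension to the larger ring.\<close>

definition multiples :: "nat set \<Rightarrow> expo set \<Rightarrow> expo set"
  where "multiples V A = {m \<in> expos V. \<exists>a\<in>A. mdvd a m}"

definition minimals :: "expo set \<Rightarrow> expo set"
  where "minimals A = {m \<in> A. \<forall>d\<in>A. mdvd d m \<longrightarrow> d = m}"

lemma expos_add [simp]: "a + b \<in> expos V \<longleftrightarrow> a \<in> expos V \<and> b \<in> expos V"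
  by (simp add: expos_def keys_add_nat)

lemma var_expo_in_expos [simp]: "var_expo i \<in> expos V \<longleftrightarrow> i \<in> V"
  by (simp add: expos_def var_expo_def)

lemma subset_multiples: "A \<subseteq> expos V \<Longrightarrow> A \<subseteq> multiples V A"
  using mdvd_refl unfolding multiples_def by blast

lemma Idl_monom:
  "A \<subseteq> expos V \<Longrightarrow> Idl\<^bsub>mpoly_ring V\<^esub> (monom ` A) = (supported (multiples V A) :: 'k::field mpoly set)"
  by (simp add: Idl_monom_eq supported_def multiples_def)

text \<open>The monomials of \<open>A\<close> lie in \<open>supported A\<close>, which lies in the
  ideal they generate, so both generate the same ideal. This computes the extension
  \<open>K'\<close> in the rule \<open>split\<close>.\<close>

lemma Idl_supported:
  assumes "A \<subseteq> expos V"
  shows "Idl\<^bsub>mpoly_ring V\<^esub> (supported A) = (supported (multiples V A) :: 'k::field mpoly set)"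
proof -
  interpret cring "mpoly_ring V :: 'k mpoly ring" by (rule cring_mpoly_ring)
  have carr: "(supported A :: 'k mpoly set) \<subseteq> carrier (mpoly_ring V)"
    unfolding supported_expos[symmetric] by (rule supported_mono[OF assms])
  have "monom ` A \<subseteq> carrier (mpoly_ring V :: 'k mpoly ring)" using carr by force
  note ideal = genideal_ideal[OF this]
  have "(supported A :: 'k mpoly set) \<subseteq> supported (multiples V A)"
    by (rule supported_mono[OF subset_multiples[OF assms]])
  then have "Idl\<^bsub>mpoly_ring V\<^esub> (supported A) \<subseteq> (supported (multiples V A) :: 'k mpoly set)"
    using genideal_minimal[OF ideal] Idl_monom[OF assms] by metis
  moreover have "(supported (multiples V A) :: 'k mpoly set) \<subseteq> Idl\<^bsub>mpoly_ring V\<^esub> (supported A)"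
    unfolding Idl_monom[OF assms, symmetric]
    by (rule genideal_minimal[OF genideal_ideal[OF carr]])
      (use genideal_self[OF carr] in force)
  ultimately show ?thesis by blast
qed

definition closed_expos :: "nat set \<Rightarrow> expo set \<Rightarrow> bool"
  where "closed_expos V A \<longleftrightarrow> A \<subseteq> expos V \<and> (\<forall>a\<in>A. \<forall>c\<in>expos V. a + c \<in> A)"

lemma multiples_closed: "closed_expos V A \<Longrightarrow> multiples V A = A"
  using subset_multiples[of A V] by (auto simp: closed_expos_def multiples_def mdvd_def)

lemma closed_multiples: "closed_expos V (multiples V A)"
  by (auto simp: closed_expos_def multiples_def mdvd_def add.assoc) blast

lemma monomial_ideal_supported:
  assumes "closed_expos V A" shows "monomial_ideal V (supported A :: 'k::field mpoly set)"
  unfolding monomial_ideal_def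
  using assms Idl_monom[of A V] multiples_closed[OF assms] by (metis closed_expos_def)

lemma min_gens_supported:
  "closed_expos V A \<Longrightarrow> min_gens V (supported A :: 'k::field mpoly set) = minimals A"
  by (auto simp: min_gens_eq monomial_ideal_supported dvd_minimal_def minimals_def)

lemma minimals_below:
  assumes "m \<in> A" shows "\<exists>d\<in>minimals A. mdvd d m"
  using assms
proof (induction m rule: measure_induct_rule[where
      f = "\<lambda>m. sum (Poly_Mapping.lookup m) (Poly_Mapping.keys m)"])
  case (less m)
  show ?case
  proof (cases "m \<in> minimals A")
    case True
    then show ?thesis by (intro bexI[of _ m]) auto
  next
    case False
    then obtain d where d: "d \<in> A" "mdvd d m" "d \<noteq> m"
      using less.prems by (auto simp: minimals_def)
    then show ?thesis using less.IH[OF mdvd_degree[OF d(2,3)] d(1)] mdvd_trans by blast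
  qed
qed

section \<open>Stable exponent sets\<close>

text \<open>The subtraction truncates, so this is x_i m / x_max(m) only if x_max(m) divides m. The
  condition \<open>i < max_var m\<close> ensures this, as \<open>max_var 0\<close> is 0.\<close>

definition shift :: "nat \<Rightarrow> expo \<Rightarrow> expo"
  where "shift i m = var_expo i + (m - var_expo (max_var m))"

lemma lookup_var_expo: "Poly_Mapping.lookup (var_expo i) j = (if i = j then 1 else 0)"
  by (simp add: var_expo_def lookup_single when_def)

lemma max_var_mem:
  assumes "i < max_var m" shows "max_var m \<in> Poly_Mapping.keys m"
  using assms by (auto simp: max_var_def split: if_splits intro!: Max_in)

lemma le_max_var: "j \<in> Poly_Mapping.keys m \<Longrightarrow> j \<le> max_var m"
  by (auto simp: max_var_def)

lemma max_var_eqI: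
  assumes "k \<in> Poly_Mapping.keys m" "\<And>j. j \<in> Poly_Mapping.keys m \<Longrightarrow> j \<le> k"
  shows "max_var m = k"
  using assms by (auto simp: max_var_def intro!: Max_eqI)

lemma add_diff_var_expo:
  assumes "k \<in> Poly_Mapping.keys m" shows "var_expo k + (m - var_expo k) = m"
  using assms by (intro poly_mapping_eqI)
    (auto simp: lookup_add lookup_minus lookup_var_expo in_keys_iff)

lemma add_minus_var_expo:
  assumes "k \<in> Poly_Mapping.keys m" shows "(m - var_expo k) + c = (m + c) - var_expo k"
  using assms by (intro poly_mapping_eqI)
    (auto simp: lookup_add lookup_minus lookup_var_expo in_keys_iff)

lemma shift_add:
  assumes "i < max_var m" "max_var (m + c) = max_var m"
  shows "shift i (m + c) = shift i m + c"
  using add_minus_var_expo[OF max_var_mem[OF assms(1)], of c] assms(2)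
  by (simp add: shift_def add.assoc)

text \<open>With the quotient multiplied out no subtraction is left, so divisibility and membership
  in \<open>expos W\<close> can be read off.\<close>

lemma shift_add_max_var:
  assumes "i < max_var m" shows "shift i m + var_expo (max_var m) = var_expo i + m"
  using add_diff_var_expo[OF max_var_mem[OF assms]] by (simp add: shift_def add_ac)

text \<open>The exchange is demanded at every monomial of the ideal, not only at minimal generators.
  In this form it passes to I : x_v and to fewer variables without knowing generators there.\<close>

definition stable_expos :: "nat set \<Rightarrow> expo set \<Rightarrow> bool"
  where "stable_expos V A \<longleftrightarrow> closed_expos V A \<and>
    (\<forall>m\<in>A. \<forall>i\<in>V. i < max_var m \<longrightarrow> shift i m \<in> A)"

text \<open>Write m as a product of a minimal generator g and a cofactor c. If x_max(m) divides c,
  the exchange takes place in c and keeps the factor g. Otherwise max(g) = max(m), and the exchange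
  takes place in g.\<close>

lemma stable_exposI:
  assumes A: "closed_expos V A"
    and gens: "\<And>m i. m \<in> minimals A \<Longrightarrow> i \<in> V \<Longrightarrow> i < max_var m \<Longrightarrow> shift i m \<in> A"
  shows "stable_expos V A"
  unfolding stable_expos_def
proof (intro conjI A ballI impI)
  fix m i assume m: "m \<in> A" and i: "i \<in> V" "i < max_var m"
  let ?k = "max_var m"
  obtain g c where g: "g \<in> minimals A" and mgc: "m = g + c"
    using minimals_below[OF m] by (auto simp: mdvd_def)
  have gA: "g \<in> A" using g by (simp add: minimals_def)
  have c: "c \<in> expos V" using m A mgc by (auto simp: closed_expos_def)
  have k: "?k \<in> Poly_Mapping.keys m" by (rule max_var_mem[OF i(2)])
  show "shift i m \<in> A"
  proof (cases "?k \<in> Poly_Mapping.keys c")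
    case True
    have "shift i m = g + (var_expo i + (c - var_expo ?k))"
      using add_minus_var_expo[OF True, of g] unfolding shift_def mgc by (metis add.commute add.left_commute)
    moreover have "var_expo i + (c - var_expo ?k) \<in> expos V"
      using i c add_diff_var_expo[OF True] by (metis expos_add var_expo_in_expos)
    ultimately show ?thesis using A gA by (auto simp: closed_expos_def)
  next
    case False
    then have kg: "?k \<in> Poly_Mapping.keys g" using k by (auto simp: mgc keys_add_nat)
    have max: "max_var g = ?k"
      by (rule max_var_eqI[OF kg]) (auto intro!: le_max_var simp: mgc keys_add_nat)
    have ig: "i < max_var g" unfolding max by (rule i(2))
    have "shift i m = shift i g + c"
      unfolding mgc by (rule shift_add[OF ig]) (simp only: max mgc[symmetric])
    moreover have "shift i g \<in> A" by (rule gens[OF g i(1) ig])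
    ultimately show ?thesis using A c unfolding closed_expos_def by simp
  qed
qed

lemma stable_ideal_supported:
  fixes I :: "'k::field mpoly set"
  assumes "stable_ideal n I"
  obtains A where "stable_expos {1..n} A" "I = supported A"
proof -
  from assms obtain S where S: "S \<subseteq> expos {1..n}"
    "I = Idl\<^bsub>mpoly_ring {1..n}\<^esub> (monom ` S)"
    by (auto simp: stable_ideal_def monomial_ideal_def)
  let ?A = "multiples {1..n} S"
  have I: "I = supported ?A" using S Idl_monom by metis
  have "stable_expos {1..n} ?A"
  proof (rule stable_exposI[OF closed_multiples])
    fix m i assume "m \<in> minimals ?A" "i \<in> {1..n}" "i < max_var m"
    then have "monom (shift i m) \<in> I"
      using assms min_gens_supported[OF closed_multiples, of "{1..n}" S, where ?'k = 'k]
      unfolding stable_ideal_def shift_def I[symmetric] by blast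
    then show "shift i m \<in> ?A" by (simp add: I)
  qed
  with I that show thesis by blast
qed

text \<open>Exchanging x_max(m) for x_v stays in \<open>A\<close> and lowers the degree in the
  variables other than x_v by one.\<close>

lemma stable_power_mem:
  assumes A: "stable_expos V A" and V: "finite V" "v \<in> V" "\<forall>j\<in>V. v \<le> j"
    and m: "m \<in> A"
  shows "\<exists>d. Poly_Mapping.single v d \<in> A"
  using m
proof (induction m rule: measure_induct_rule[where f = "\<lambda>m. sum (Poly_Mapping.lookup m) (V - {v})"])
  case (less m)
  let ?k = "max_var m"
  have keys: "Poly_Mapping.keys m \<subseteq> V"
    using less.prems A by (auto simp: stable_expos_def closed_expos_def expos_def)
  show ?case
  proof (cases "v < ?k")
    case True
    have k: "?k \<in> Poly_Mapping.keys m" by (rule max_var_mem[OF True])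
    have "sum (Poly_Mapping.lookup (shift v m)) (V - {v}) < sum (Poly_Mapping.lookup m) (V - {v})"
      by (rule sum_strict_mono_ex1)
        (use V k keys True in \<open>auto simp: shift_def lookup_add lookup_minus lookup_var_expo
          in_keys_iff intro!: bexI[of _ ?k]\<close>)
    moreover have "shift v m \<in> A" using A less.prems V True by (auto simp: stable_expos_def)
    ultimately show ?thesis using less.IH by blast
  next
    case False
    \<comment> \<open>No variable of m lies above v, and none in \<open>V\<close> lies below. The
      case m = 0 is included, with d = 0.\<close>
    have "Poly_Mapping.keys m \<subseteq> {v}"
      using False keys V(3) le_max_var by fastforce
    then have "m = Poly_Mapping.single v (Poly_Mapping.lookup m v)"
      by (intro poly_mapping_eqI) (auto simp: lookup_single when_def in_keys_iff)
    then show ?thesis using less.prems by metis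
  qed
qed

section \<open>Splitting off the first variable\<close>

text \<open>\<open>D\<close> holds the exponents of x_v J, and \<open>multiples V C\<close> those of
  the extension of K. A divisor of a monomial free of x_v is free of x_v, which settles minimality
  for the second set. Stability enters for \<open>D\<close>.\<close>

lemma minimals_split:
  assumes A: "stable_expos V A" and v: "v \<in> V" "\<forall>j\<in>V. v \<le> j" and "0 \<notin> A"
  defines "C \<equiv> A \<inter> expos (V - {v})" and "D \<equiv> {m \<in> A. v \<in> Poly_Mapping.keys m}"
  shows "minimals A = minimals D \<union> minimals (multiples V C)"
    and "minimals D \<inter> minimals (multiples V C) = {}"
proof -
  have clA: "closed_expos V A" using A by (simp add: stable_expos_def)
  have C_iff: "m \<in> C \<longleftrightarrow> m \<in> A \<and> v \<notin> Poly_Mapping.keys m" for m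
    using clA by (auto simp: C_def closed_expos_def expos_def)
  have CM: "C \<subseteq> multiples V C"
    by (rule subset_multiples) (use clA in \<open>auto simp: closed_expos_def C_iff\<close>)
  have MA: "multiples V C \<subseteq> A"
    using clA by (auto simp: multiples_def closed_expos_def C_iff mdvd_def)
  have MC: "minimals (multiples V C) \<subseteq> C"
  proof
    fix m assume m: "m \<in> minimals (multiples V C)"
    then obtain c where "c \<in> C" "mdvd c m" by (auto simp: minimals_def multiples_def)
    moreover from this have "c = m" using m CM by (auto simp: minimals_def)
    ultimately show "m \<in> C" by simp
  qed
  have keys_mono: "Poly_Mapping.keys d \<subseteq> Poly_Mapping.keys m" if "mdvd d m" for d m
    using that by (auto simp: mdvd_def keys_add_nat)
  have D_sub: "m \<in> minimals A" if m: "m \<in> minimals D" for m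
  proof -
    have "d = m" if d: "d \<in> A" "mdvd d m" for d
    proof (cases "v \<in> Poly_Mapping.keys d")
      case True
      then show ?thesis using m d by (auto simp: minimals_def D_def)
    next
      case False
      from d obtain c where c: "m = d + c" by (auto simp: mdvd_def)
      have "v \<in> Poly_Mapping.keys m" using m by (simp add: minimals_def D_def)
      then have vc: "v \<in> Poly_Mapping.keys c" using False by (auto simp: c keys_add_nat)
      have dvd: "mdvd (d + var_expo v) m"
        using add_diff_var_expo[OF vc] by (auto simp: c mdvd_def add.assoc intro!: exI[of _ "c - var_expo v"])
      \<comment> \<open>For I = R the claim fails: x_v is minimal in \<open>D\<close> but not in
        \<open>A\<close>. Here d has a variable, and all its variables lie above v, so x_v can be
        exchanged in.\<close>
      have "d \<noteq> 0" using d \<open>0 \<notin> A\<close> by auto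
      then obtain j where j: "j \<in> Poly_Mapping.keys d" by fastforce
      moreover have "Poly_Mapping.keys d \<subseteq> V" using d clA by (auto simp: closed_expos_def expos_def)
      ultimately have "v < j" using v(2) False by (metis le_neq_implies_less subsetD)
      then have less: "v < max_var d" using le_max_var[OF j] by simp
      let ?e = "shift v d"
      have "?e \<in> A" using A d v less by (auto simp: stable_expos_def)
      moreover have "v \<in> Poly_Mapping.keys ?e" by (simp add: shift_def keys_add_nat) (simp add: var_expo_def)
      moreover have e: "?e + var_expo (max_var d) = d + var_expo v"
        using shift_add_max_var[OF less] by (simp add: add.commute)
      then have "mdvd ?e (d + var_expo v)" by (metis mdvd_def)
      ultimately have "?e = m" "mdvd ?e (d + var_expo v)"
        using m dvd mdvd_trans by (auto simp: minimals_def D_def)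
      then have "?e = d + var_expo v" using dvd by (intro mdvd_antisym) auto
      \<comment> \<open>Minimality of m has squeezed \<open>?e\<close> and x_v d together, so
        cancelling makes x_max(d) equal to 1, a contradiction.\<close>
      with e have "var_expo (max_var d) = 0" by (metis add_cancel_left_right)
      then show ?thesis by (metis lookup_var_expo lookup_zero zero_neq_one)
    qed
    then show ?thesis using m by (auto simp: minimals_def D_def)
  qed
  have M_sub: "m \<in> minimals A" if m: "m \<in> minimals (multiples V C)" for m
  proof -
    have mC: "m \<in> C" using m MC by blast
    have "d = m" if "d \<in> A" "mdvd d m" for d
    proof -
      have "d \<in> C" using that mC keys_mono by (auto simp: C_iff)
      then show ?thesis using m that CM by (auto simp: minimals_def)
    qed
    then show ?thesis using mC by (auto simp: minimals_def C_iff)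
  qed
  have "m \<in> minimals D \<union> minimals (multiples V C)" if m: "m \<in> minimals A" for m
    using m MA CM by (cases "v \<in> Poly_Mapping.keys m") (auto simp: minimals_def D_def C_iff)
  with D_sub M_sub show "minimals A = minimals D \<union> minimals (multiples V C)" by blast
  show "minimals D \<inter> minimals (multiples V C) = {}"
    using MC by (auto simp: minimals_def D_def C_iff)
qed

text \<open>An exchange at m with i in \<open>V\<close> requires v \<le> i < max(m), so multiplying
  by x_v does not change max(m) and commutes with the exchange.\<close>

lemma stable_expos_quotient:
  assumes A: "stable_expos V A" and least: "\<forall>j\<in>V. v \<le> j"
  shows "stable_expos V {m. var_expo v + m \<in> A}"
  unfolding stable_expos_def
proof (intro conjI ballI impI)
  show "closed_expos V {m. var_expo v + m \<in> A}"
    using A by (auto simp: stable_expos_def closed_expos_def add.assoc[symmetric])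
  fix m i assume m: "m \<in> {m. var_expo v + m \<in> A}" and i: "i \<in> V" "i < max_var m"
  have "max_var (m + var_expo v) = max_var m"
    by (rule max_var_eqI)
      (use max_var_mem[OF i(2)] le_max_var[of _ m] least i(1) i(2) in
        \<open>auto simp: keys_add_nat, auto simp: var_expo_def\<close>)
  then have "shift i (m + var_expo v) = shift i m + var_expo v" "i < max_var (m + var_expo v)"
    using i by (simp_all add: shift_add)
  then show "shift i m \<in> {m. var_expo v + m \<in> A}"
    using A m i by (simp add: stable_expos_def add.commute[of "var_expo v"]) metis
qed

lemma stable_expos_restrict:
  assumes "stable_expos V A" "W \<subseteq> V"
  shows "stable_expos W (A \<inter> expos W)"
proof -
  have "shift i m \<in> expos W" if "m \<in> expos W" "i \<in> W" "i < max_var m" for i m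
    using shift_add_max_var[OF that(3)] that by (metis expos_add var_expo_in_expos)
  moreover have "c \<in> expos V" if "c \<in> expos W" for c
    using that assms(2) by (auto simp: expos_def)
  ultimately show ?thesis
    using assms by (auto simp: stable_expos_def closed_expos_def)
qed

text \<open>Each condition of the rule \<open>split\<close> becomes one on exponents: x_v J gives
  \<open>?D\<close>, the extension of K gives \<open>multiples V ?C\<close>, and the sum gives their
  union.\<close>

lemma vertex_splittable_supported_split:
  assumes A: "stable_expos V A" and v: "v \<in> V" "\<forall>j\<in>V. v \<le> j" and "0 \<notin> A"
    and J: "vertex_splittable V (supported {m. var_expo v + m \<in> A} :: 'k::field mpoly set)"
    and K: "vertex_splittable (V - {v}) (supported (A \<inter> expos (V - {v})) :: 'k mpoly set)"
  shows "vertex_splittable V (supported A :: 'k mpoly set)"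
proof -
  let ?B = "{m. var_expo v + m \<in> A}" and ?C = "A \<inter> expos (V - {v})"
    and ?D = "{m \<in> A. v \<in> Poly_Mapping.keys m}"
  have clA: "closed_expos V A" using A by (simp add: stable_expos_def)
  have clD: "closed_expos V ?D" using clA by (auto simp: closed_expos_def keys_add_nat)
  have CV: "?C \<subseteq> expos V" by (auto simp: expos_def)
  have MA: "multiples V ?C \<subseteq> A" using clA by (auto simp: multiples_def closed_expos_def mdvd_def)
  \<comment> \<open>Since I is contained in I : x_v, this yields the required inclusion of K in
    J.\<close>
  have AB: "A \<subseteq> ?B" using clA v by (auto simp: closed_expos_def add.commute[of "var_expo v"])
  have D: "(+) (var_expo v) ` ?B = ?D"
  proof
    show "(+) (var_expo v) ` ?B \<subseteq> ?D"
      by (auto simp: keys_add_nat) (simp add: var_expo_def)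
    show "?D \<subseteq> (+) (var_expo v) ` ?B"
    proof
      fix m assume m: "m \<in> ?D"
      then have "var_expo v + (m - var_expo v) = m" by (intro add_diff_var_expo) simp
      with m show "m \<in> (+) (var_expo v) ` ?B" by (intro image_eqI[of _ _ "m - var_expo v"]) auto
    qed
  qed
  have un: "?D \<union> multiples V ?C = A"
    using MA clA subset_multiples[OF CV] by (auto simp: closed_expos_def expos_def)
  show ?thesis
  proof (rule vertex_splittable.split[OF v(1) J K refl])
    show "supported A = var v <#\<^bsub>mpoly_ring V\<^esub> supported ?B <+>\<^bsub>mpoly_ring V\<^esub>
        Idl\<^bsub>mpoly_ring V\<^esub> (supported ?C :: 'k mpoly set)"
      by (simp only: supported_coset D Idl_supported[OF CV] supported_Un un)
    show "Idl\<^bsub>mpoly_ring V\<^esub> (supported ?C) \<subseteq> (supported ?B :: 'k mpoly set)"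
      unfolding Idl_supported[OF CV] by (rule supported_mono) (use MA AB in blast)
    show "min_gens V (supported A :: 'k mpoly set) =
        min_gens V (var v <#\<^bsub>mpoly_ring V\<^esub> supported ?B :: 'k mpoly set) \<union>
        min_gens V (Idl\<^bsub>mpoly_ring V\<^esub> (supported ?C) :: 'k mpoly set)"
      by (simp only: supported_coset D Idl_supported[OF CV] min_gens_supported clA clD
          closed_multiples minimals_split(1)[OF A v \<open>0 \<notin> A\<close>])
    show "min_gens V (var v <#\<^bsub>mpoly_ring V\<^esub> supported ?B :: 'k mpoly set) \<inter>
        min_gens V (Idl\<^bsub>mpoly_ring V\<^esub> (supported ?C) :: 'k mpoly set) = {}"
      by (simp only: supported_coset D Idl_supported[OF CV] min_gens_supported clA clD
          closed_multiples minimals_split(2)[OF A v \<open>0 \<notin> A\<close>])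
  qed
qed

section \<open>The double induction\<close>

lemma vertex_splittable_supported_whole:
  assumes "closed_expos V A" "0 \<in> A"
  shows "vertex_splittable V (supported A :: 'k::field mpoly set)"
proof -
  have "A = expos V" using assms by (force simp: closed_expos_def)
  then show ?thesis by (simp add: supported_expos vertex_splittable.whole)
qed

lemma vertex_splittable_supported:
  assumes "finite V" "stable_expos V A"
  shows "vertex_splittable V (supported A :: 'k::field mpoly set)"
  using assms
proof (induction V arbitrary: A rule: finite_psubset_induct)
  case (psubset V)
  have clA: "closed_expos V A" using psubset.prems by (simp add: stable_expos_def)
  consider "A = {}" | "V = {}" "A \<noteq> {}" | "V \<noteq> {}" "A \<noteq> {}" by blast
  then show ?case
  proof cases
    \<comment> \<open>The zero ideal contains no power of x_v, so it is treated apart.\<close>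
    case 1
    then show ?thesis using vertex_splittable.zero[of V] by (simp add: supported_empty)
  next
    case 2
    \<comment> \<open>Without variables the only monomial is 1.\<close>
    then have "0 \<in> A" using clA by (auto simp: closed_expos_def expos_def)
    then show ?thesis by (rule vertex_splittable_supported_whole[OF clA])
  next
    case 3
    define v where "v = Min V"
    have v: "v \<in> V" "\<forall>j\<in>V. v \<le> j" using 3 psubset.hyps by (auto simp: v_def)
    obtain d where "Poly_Mapping.single v d \<in> A"
      using 3 stable_power_mem[OF psubset.prems psubset.hyps v] by blast
    with psubset.prems show ?thesis
    proof (induction d arbitrary: A)
      case 0
      then show ?case by (intro vertex_splittable_supported_whole) (auto simp: stable_expos_def)
    next
      case (Suc d)
      show ?case
      proof (cases "0 \<in> A")
        case True
        then show ?thesis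
          using Suc.prems by (intro vertex_splittable_supported_whole) (auto simp: stable_expos_def)
      next
        case False
        have "var_expo v + Poly_Mapping.single v d = Poly_Mapping.single v (Suc d)"
          by (simp add: var_expo_def single_add[symmetric])
        then have J: "vertex_splittable V (supported {m. var_expo v + m \<in> A} :: 'k mpoly set)"
          using Suc.prems by (intro Suc.IH stable_expos_quotient v(2)) auto
        \<comment> \<open>K may contain no power of x_v or of the next variable below a known bound.
          None is needed, as the outer hypothesis covers every stable set on fewer
          variables.\<close>
        have "vertex_splittable (V - {v}) (supported (A \<inter> expos (V - {v})) :: 'k mpoly set)"
          using v(1) by (intro psubset.IH stable_expos_restrict[OF Suc.prems(1)]) auto
        then show ?thesis by (rule vertex_splittable_supported_split[OF Suc.prems(1) v False J])
      qed
    qed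
  qed
qed

theorem theorem1:
  fixes n :: nat and I :: "'k::field mpoly set"
  assumes "stable_ideal n I"
  shows "vertex_splittable {1..n} I"
proof -
  obtain A where "stable_expos {1..n} A" "I = supported A"
    using assms by (rule stable_ideal_supported)
  then show ?thesis by (simp add: vertex_splittable_supported)
qed

end
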